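(* Let $n\ge 2$, let $A=B+iC\in\mathcal H_n$ (so $B,C\in\mathbb R^{n\times n}$ are symmetric positive definite), and let $\omega\in[1,\infty)$ satisfy $\max\{\kappa(B),\kappa(C)\}\le\omega$. Then Gaussian elimination without pivoting applied to $A$ is well defined (no zero pivot occurs), and for every elimination stage $1\le k\le n-1$, $$\frac1\omega\le \rho_{n,k}(A)\le \frac{2(1+\omega^2)}{(1+\omega)^2},\qquad \rho_{n,k}(A):=\frac{\max_{i,j}|a_{ij}^{(k)}|}{\max_{i,j}|a_{ij}|}.$$ Consequently the growth factor satisfies $$\frac1\omega\le \rho_n(A)\le \frac{2(1+\omega^2)}{(1+\omega)^2}.$$
   Context: $\mathcal H_n$ (Higham matrices of order $n$) is the set of complex matrices $P+iQ$ with $P,Q\in\mathbb R^{n\times n}$ symmetric positive definite. For an invertible matrix $X$, $\kappa(X)=\|X\|\,\|X^{-1}\|$ with $\|\cdot\|$ the spectral norm. For $A=(a_{ij})\in\mathbb C^{n\times n}$ and $1\le k\le n-1$, $A^{(k)}=(a^{(k)}_{ij})\in\mathbb C^{(n-k)\times(n-k)}$ is the active matrix remaining after $k$ steps of Gaussian elimination without pivoting, i.e. the Schur complement $A_{22}-A_{21}A_{11}^{-1}A_{12}$ of the leading $k\times k$ principal block $A_{11}$ of $A$. The growth factor is (post-elimination convention, $k=0$ is not included) $$\rho_n(A)=\frac{\max_{1\le k\le n-1}\max_{i,j}|a_{ij}^{(k)}|}{\max_{i,j}|a_{ij}|}.$$ *)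

theory Defs
  imports
    "HOL-Analysis.L2_Norm"
    "Jordan_Normal_Form.Determinant"
begin

definition sym_pos_def :: "real mat \<Rightarrow> bool" where
  "sym_pos_def P \<longleftrightarrow>
     square_mat P \<and> transpose_mat P = P \<and>
     (\<forall>x\<in>carrier_vec (dim_row P). x \<noteq> 0\<^sub>v (dim_row P) \<longrightarrow> x \<bullet> (P *\<^sub>v x) > 0)"

definition complex_mat :: "real mat \<Rightarrow> real mat \<Rightarrow> complex mat" where
  "complex_mat P Q = map_mat complex_of_real P + \<i> \<cdot>\<^sub>m map_mat complex_of_real Q"

definition higham_mats :: "nat \<Rightarrow> complex mat set" where
  "higham_mats n =
     {complex_mat P Q | P Q. P \<in> carrier_mat n n \<and> Q \<in> carrier_mat n n \<and>
        sym_pos_def P \<and> sym_pos_def Q}"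

definition l2_norm_vec :: "'a::real_normed_field vec \<Rightarrow> real" where
  "l2_norm_vec v = L2_set (\<lambda>i. norm (v $ i)) {..<dim_vec v}"

text \<open>The operator norm induced by the Euclidean norm.  The supremum is meaningful only for
  matrices with at least one column.\<close>

definition spectral_norm :: "'a::real_normed_field mat \<Rightarrow> real" where
  "spectral_norm X =
     (SUP v \<in> {v \<in> carrier_vec (dim_col X). l2_norm_vec v = 1}. l2_norm_vec (X *\<^sub>v v))"

text \<open>Unspecified if the matrix is not invertible.\<close>

definition mat_inv :: "'a::field mat \<Rightarrow> 'a mat" where
  "mat_inv X = the (mat_inverse X)"

definition cond_number :: "'a::real_normed_field mat \<Rightarrow> real" where
  "cond_number X = spectral_norm X * spectral_norm (mat_inv X)"

text \<open>One step of Gaussian elimination without pivoting: the first row and column are eliminated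
  and dropped.  As \<open>x / 0 = 0\<close>, the step is meaningful only if the pivot, i.e. the entry at
  position \<open>(0, 0)\<close>, is nonzero.\<close>

definition ge_step :: "'a::field mat \<Rightarrow> 'a mat" where
  "ge_step A = mat (dim_row A - 1) (dim_col A - 1)
     (\<lambda>(i, j). A $$ (i + 1, j + 1) - A $$ (i + 1, 0) / A $$ (0, 0) * A $$ (0, j + 1))"

fun ge_active :: "'a::field mat \<Rightarrow> nat \<Rightarrow> 'a mat" where
  "ge_active A 0 = A"
| "ge_active A (Suc k) = ge_step (ge_active A k)"

definition ge_pivot :: "'a::field mat \<Rightarrow> nat \<Rightarrow> 'a" where
  "ge_pivot A k = ge_active A k $$ (0, 0)"

text \<open>For a matrix of order \<open>n\<close> the pivots are those with index \<open>k < n\<close>; the last one, the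
  remaining \<open>1 \<times> 1\<close> active matrix, is never divided by but is the last diagonal
  entry of the upper triangular factor.\<close>

definition ge_well_defined :: "'a::field mat \<Rightarrow> bool" where
  "ge_well_defined A \<longleftrightarrow> (\<forall>k<dim_row A. ge_pivot A k \<noteq> 0)"

definition max_entry :: "complex mat \<Rightarrow> real" where
  "max_entry A = Max (cmod ` elements_mat A)"

definition stage_growth :: "complex mat \<Rightarrow> nat \<Rightarrow> real" where
  "stage_growth A k = max_entry (ge_active A k) / max_entry A"

definition growth_factor :: "complex mat \<Rightarrow> real" where
  "growth_factor A = Max ((\<lambda>k. max_entry (ge_active A k)) ` {1..dim_row A - 1}) / max_entry A"

text \<open>As long as no zero pivot has occurred, the active matrix is the Schur complement of the
  leading principal block.\<close>

definition schur_complement :: "'a::field mat \<Rightarrow> nat \<Rightarrow> 'a mat" where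
  "schur_complement A k =
     (case split_block A k k of (A11, A12, A21, A22) \<Rightarrow> A22 - A21 * mat_inv A11 * A12)"

lemma ge_active_carrier:
  assumes "A \<in> carrier_mat n n"
  shows "ge_active A k \<in> carrier_mat (n - k) (n - k)"
  using assms by (induction k) (auto simp: ge_step_def)

lemma ge_active_row_combination:
  fixes A :: "'a::field mat"
  assumes A: "A \<in> carrier_mat n n" and "k \<le> n" and "\<forall>l<k. ge_pivot A l \<noteq> 0"
  shows "\<exists>m. \<forall>i<n - k. \<forall>j<n. A $$ (k + i, j) - (\<Sum>l<k. m i l * A $$ (l, j)) =
           (if j < k then 0 else ge_active A k $$ (i, j - k))"
  using assms(2,3)
proof (induction k)
  case 0
  then show ?case by auto
next
  case (Suc k)
  then have "k \<le> n" "\<forall>l<k. ge_pivot A l \<noteq> 0"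
    by simp_all
  from Suc.IH[OF this] obtain m where "\<forall>i<n - k. \<forall>j<n.
      A $$ (k + i, j) - (\<Sum>l<k. m i l * A $$ (l, j)) =
      (if j < k then 0 else ge_active A k $$ (i, j - k))" ..
  then have m: "A $$ (k + i, j) - (\<Sum>l<k. m i l * A $$ (l, j)) =
      (if j < k then 0 else ge_active A k $$ (i, j - k))" if "i < n - k" "j < n" for i j
    using that by (elim allE impE) assumption+
  define G where "G = ge_active A k"
  have G: "G \<in> carrier_mat (n - k) (n - k)"
    unfolding G_def by (rule ge_active_carrier[OF A])
  have p: "G $$ (0, 0) \<noteq> 0"
    using Suc.prems by (auto simp: G_def ge_pivot_def)
  define f where "f i = G $$ (i + 1, 0) / G $$ (0, 0)" for i
  define m' where "m' i l = (if l < k then m (i + 1) l - f i * m 0 l else f i)" for i l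
  have "A $$ (Suc k + i, j) - (\<Sum>l<Suc k. m' i l * A $$ (l, j)) =
      (if j < Suc k then 0 else ge_active A (Suc k) $$ (i, j - Suc k))"
    if i: "i < n - Suc k" and j: "j < n" for i j
  proof -
    have "(\<Sum>l<Suc k. m' i l * A $$ (l, j)) = (\<Sum>l<k. (m (i + 1) l - f i * m 0 l) * A $$ (l, j))
        + f i * A $$ (k, j)"
      by (simp add: m'_def)
    also have "\<dots> = (\<Sum>l<k. m (i + 1) l * A $$ (l, j)) - f i * (\<Sum>l<k. m 0 l * A $$ (l, j))
        + f i * A $$ (k, j)"
      by (simp add: left_diff_distrib sum_subtractf sum_distrib_left mult.assoc)
    finally have "A $$ (Suc k + i, j) - (\<Sum>l<Suc k. m' i l * A $$ (l, j)) =
        (A $$ (k + (i + 1), j) - (\<Sum>l<k. m (i + 1) l * A $$ (l, j)))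
        - f i * (A $$ (k + 0, j) - (\<Sum>l<k. m 0 l * A $$ (l, j)))"
      by (simp add: algebra_simps)
    also have "\<dots> = (if j < k then 0 else G $$ (i + 1, j - k)) -
        f i * (if j < k then 0 else G $$ (0, j - k))"
      using m[of "i + 1" j] m[of 0 j] i j by (simp add: G_def)
    also have "\<dots> = (if j < Suc k then 0 else ge_active A (Suc k) $$ (i, j - Suc k))"
    proof (cases "j < Suc k")
      case True
      then show ?thesis
        using p by (cases "j = k") (auto simp: f_def)
    next
      case False
      then have "j - k = Suc (j - Suc k)" "j - Suc k < n - Suc k"
        using j by auto
      then show ?thesis
        using False i G by (simp add: G_def[symmetric] ge_step_def f_def)
    qed
    finally show ?thesis .
  qed
  then show ?case by blast
qed

lemma leading_block_kernel:
  fixes A :: "'a::field mat"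
  assumes A: "A \<in> carrier_mat n n" and "k \<le> n" and "\<forall>l<k. ge_pivot A l \<noteq> 0"
    and "\<forall>i<k. (\<Sum>j<k. A $$ (i, j) * x j) = 0"
  shows "\<forall>j<k. x j = 0"
  using assms(2-)
proof (induction k)
  case 0
  then show ?case by auto
next
  case (Suc k)
  have "k \<le> n" "\<forall>l<k. ge_pivot A l \<noteq> 0"
    using Suc.prems by simp_all
  from ge_active_row_combination[OF A this] obtain m where "\<forall>i<n - k. \<forall>j<n.
      A $$ (k + i, j) - (\<Sum>l<k. m i l * A $$ (l, j)) =
      (if j < k then 0 else ge_active A k $$ (i, j - k))" ..
  then have m: "A $$ (k + i, j) - (\<Sum>l<k. m i l * A $$ (l, j)) =
      (if j < k then 0 else ge_active A k $$ (i, j - k))" if "i < n - k" "j < n" for i j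
    using that by (elim allE impE) assumption+
  have "(\<Sum>j<Suc k. (A $$ (k, j) - (\<Sum>l<k. m 0 l * A $$ (l, j))) * x j) =
      (\<Sum>j<Suc k. A $$ (k, j) * x j) - (\<Sum>j<Suc k. \<Sum>l<k. m 0 l * (A $$ (l, j) * x j))"
    by (simp add: left_diff_distrib sum_subtractf sum_distrib_right mult.assoc del: sum.lessThan_Suc)
  also have "(\<Sum>j<Suc k. \<Sum>l<k. m 0 l * (A $$ (l, j) * x j)) =
      (\<Sum>l<k. m 0 l * (\<Sum>j<Suc k. A $$ (l, j) * x j))"
    by (subst sum.swap) (simp add: sum_distrib_left del: sum.lessThan_Suc)
  also have "\<dots> = 0"
    using Suc.prems(3) by (intro sum.neutral) (simp del: sum.lessThan_Suc)
  finally have "(\<Sum>j<Suc k. (A $$ (k, j) - (\<Sum>l<k. m 0 l * A $$ (l, j))) * x j) = 0"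
    using Suc.prems(3) by (simp del: sum.lessThan_Suc)
  moreover have "(\<Sum>j<Suc k. (A $$ (k, j) - (\<Sum>l<k. m 0 l * A $$ (l, j))) * x j) =
      (\<Sum>j<Suc k. (if j < k then 0 else ge_pivot A k) * x j)"
    using m[of 0] Suc.prems(1) by (intro sum.cong) (auto simp: ge_pivot_def)
  ultimately have "x k = 0"
    using Suc.prems(2) by simp
  moreover have "\<forall>j<k. x j = 0"
    using Suc.prems \<open>x k = 0\<close> by (intro Suc.IH) auto
  ultimately show ?case
    using less_Suc_eq by auto
qed

lemma mat_inv_unit:
  assumes A: "A \<in> carrier_mat n n" and d: "det A \<noteq> 0"
  shows "A * mat_inv A = 1\<^sub>m n" "mat_inv A * A = 1\<^sub>m n" "mat_inv A \<in> carrier_mat n n"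
proof -
  have "mat_inverse A \<noteq> None"
    using mat_inverse(1)[OF A, of "()"] det_non_zero_imp_unit[OF A d, of "()"] by auto
  then have "mat_inverse A = Some (mat_inv A)"
    by (auto simp: mat_inv_def)
  from mat_inverse(2)[OF A this]
  show "A * mat_inv A = 1\<^sub>m n" "mat_inv A * A = 1\<^sub>m n" "mat_inv A \<in> carrier_mat n n"
    by auto
qed

lemma ge_active_eq_schur_complement:
  fixes A :: "'a::field mat"
  assumes A: "A \<in> carrier_mat n n" and k: "k \<le> n" and p: "\<forall>l<k. ge_pivot A l \<noteq> 0"
  shows "ge_active A k = schur_complement A k"
proof -
  define A11 where "A11 = mat k k (\<lambda>ij. A $$ ij)"
  define A12 where "A12 = mat k (n - k) (\<lambda>(i, j). A $$ (i, j + k))"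
  define A21 where "A21 = mat (n - k) k (\<lambda>(i, j). A $$ (i + k, j))"
  define A22 where "A22 = mat (n - k) (n - k) (\<lambda>(i, j). A $$ (i + k, j + k))"
  have S: "schur_complement A k = A22 - A21 * mat_inv A11 * A12"
    using A by (auto simp: schur_complement_def split_block_def Let_def
        A11_def A12_def A21_def A22_def)
  have A11: "A11 \<in> carrier_mat k k" by (simp add: A11_def)
  have "det A11 \<noteq> 0"
  proof
    assume "det A11 = 0"
    then obtain v where v: "v \<in> carrier_vec k" "v \<noteq> 0\<^sub>v k" "A11 *\<^sub>v v = 0\<^sub>v k"
      using det_0_iff_vec_prod_zero[OF A11] by auto
    have "\<forall>i<k. (\<Sum>j<k. A $$ (i, j) * v $ j) = 0"
    proof (intro allI impI)
      fix i assume i: "i < k"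
      have "(A11 *\<^sub>v v) $ i = 0" using v(3) i by simp
      moreover have "(A11 *\<^sub>v v) $ i = (\<Sum>j<k. A $$ (i, j) * v $ j)"
        using i v(1) by (simp add: A11_def scalar_prod_def atLeast0LessThan)
      ultimately show "(\<Sum>j<k. A $$ (i, j) * v $ j) = 0" by simp
    qed
    from leading_block_kernel[OF A k p this] have "v = 0\<^sub>v k"
      using v(1) by (intro eq_vecI) auto
    with v(2) show False by simp
  qed
  note inv = mat_inv_unit[OF A11 this]
  from ge_active_row_combination[OF A k p] obtain m where "\<forall>i<n - k. \<forall>j<n.
      A $$ (k + i, j) - (\<Sum>l<k. m i l * A $$ (l, j)) =
      (if j < k then 0 else ge_active A k $$ (i, j - k))" ..
  then have m: "A $$ (k + i, j) - (\<Sum>l<k. m i l * A $$ (l, j)) =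
      (if j < k then 0 else ge_active A k $$ (i, j - k))" if "i < n - k" "j < n" for i j
    using that by (elim allE impE) assumption+
  define M where "M = mat (n - k) k (\<lambda>(i, l). m i l)"
  have M: "M \<in> carrier_mat (n - k) k" by (simp add: M_def)
  have "A21 = M * A11"
  proof (rule eq_matI)
    fix i j assume "i < dim_row (M * A11)" "j < dim_col (M * A11)"
    then have ij: "i < n - k" "j < k" by (auto simp: M_def A11_def)
    then have "A $$ (k + i, j) = (\<Sum>l<k. m i l * A $$ (l, j))"
      using m[of i j] k by simp
    then show "A21 $$ (i, j) = (M * A11) $$ (i, j)"
      using ij by (simp add: A21_def M_def A11_def scalar_prod_def atLeast0LessThan add.commute)
  qed (auto simp: A21_def M_def A11_def)
  then have "A21 * mat_inv A11 = M"
    using inv M A11 by (simp add: assoc_mult_mat[OF M A11])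
  then have "schur_complement A k = A22 - M * A12"
    using S by simp
  moreover have "ge_active A k = A22 - M * A12"
  proof (rule eq_matI)
    fix i j assume "i < dim_row (A22 - M * A12)" "j < dim_col (A22 - M * A12)"
    then have ij: "i < n - k" "j < n - k" by (auto simp: M_def A12_def)
    then show "ge_active A k $$ (i, j) = (A22 - M * A12) $$ (i, j)"
      using m[of i "j + k"]
      by (simp add: A22_def M_def A12_def scalar_prod_def atLeast0LessThan add.commute)
  qed (use ge_active_carrier[OF A, of k] in \<open>auto simp: M_def A12_def\<close>)
  ultimately show ?thesis by simp
qed

end

theory Submission
  imports Defs
begin

text \<open>Why the bounds hold.  Let \<open>s = S\<^sub>i\<^sub>i\<close> be a diagonal entry of the active matrix \<open>S\<close> after
  \<open>k\<close> steps, and put \<open>r = k + i\<close>.  Elimination adds to row \<open>r\<close> of \<open>A\<close> a combination of the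
  first \<open>k\<close> rows.  With \<open>Z\<close> the vector of coefficients of all rows (\<open>Z = e\<^sub>r\<close> beyond the
  first \<open>k\<close> positions), \<open>Z\<^sup>T A\<close> vanishes on the first \<open>k\<close> positions and \<open>s = Z\<^sup>T A y\<close> for
  every \<open>y\<close> that agrees with \<open>e\<^sub>r\<close> on the others.

  Taking for \<open>y\<close> the conjugate of \<open>Z\<close> shows that \<open>Re s\<close> and \<open>Im s\<close> are sums of values of
  the forms of \<open>B\<close> and \<open>C\<close> at the real and the imaginary part of \<open>Z\<close>.  Three things
  follow.  Pivots are nonzero (\<open>pivot_nonzero\<close>).  The real and the imaginary part
  of \<open>S\<close> are positive semidefinite, so the largest entry in modulus can be found on the diagonal
  (\<open>S_entry_le_diagonal\<close>); the case \<open>k = 0\<close> is the same assertion for \<open>A\<close>.  And since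
  \<open>Re Z\<close> has length at least \<open>1\<close>, the bound \<open>\<omega>\<close> on the condition numbers, which says that
  the forms of \<open>B\<close> and \<open>C\<close> vary by a factor of at most \<open>\<omega>\<close> on vectors of equal length
  (\<open>cond_number_bform_le\<close>), gives the lower bound (\<open>A_diag_le_S_diag\<close>).

  For the upper bound let \<open>a = A\<^sub>r\<^sub>r\<close> and \<open>z = e\<^sub>r - Z\<close>, so that \<open>s = a - z\<^sup>T A z\<close>.  Wielandt's
  inequality (\<open>Wielandt_inequality\<close>) says that real corrections orthogonal to \<open>e\<^sub>r\<close> cannot
  lower the forms of \<open>B\<close> and \<open>C\<close> at \<open>e\<^sub>r\<close> by more than the fraction
  \<open>t = ((\<omega> - 1) / (\<omega> + 1))\<^sup>2\<close> of their value.  The point is to reach the factor \<open>1 + t\<close>, which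
  is \<open>2 (1 + \<omega>\<^sup>2) / (1 + \<omega>)\<^sup>2\<close>, from a complex \<open>z\<close> without estimating its two parts
  separately.  Choose the angle \<open>\<alpha>\<close> with \<open>3 \<alpha> = \<pi> - arg s\<close>, which lies in the first
  quadrant.  Then \<open>\<bar>s\<bar> = Re (- e\<^sup>3\<^sup>i\<^sup>\<alpha> a) + Re (e\<^sup>3\<^sup>i\<^sup>\<alpha> z\<^sup>T A z)\<close>, and for \<open>w = e\<^sup>2\<^sup>i\<^sup>\<alpha> z = u + i v\<close>
  with real \<open>u\<close> and \<open>v\<close> the last term is
  \<open>Re (e\<^sup>-\<^sup>i\<^sup>\<alpha> (2 u\<^sup>T A w - u\<^sup>T A u - v\<^sup>T A v))\<close>.  Here \<open>Re (e\<^sup>-\<^sup>i\<^sup>\<alpha> v\<^sup>T A v)\<close> is a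
  nonnegative combination of the forms of \<open>B\<close> and \<open>C\<close> at \<open>v\<close> and can be dropped, while
  \<open>e\<^sup>-\<^sup>i\<^sup>\<alpha> u\<^sup>T A w = e\<^sup>i\<^sup>\<alpha> u\<^sup>T A e\<^sub>r\<close>: the rotations cancel.  What remains is
  \<open>cos \<alpha>\<close> times Wielandt's expression for \<open>B\<close> and \<open>u\<close> plus \<open>sin \<alpha>\<close> times that for
  \<open>C\<close> and \<open>- u\<close>, hence at most \<open>t Re (e\<^sup>-\<^sup>i\<^sup>\<alpha> a) \<le> t \<bar>a\<bar>\<close> (\<open>S_diag_le_A_diag\<close>).\<close>

section \<open>Bilinear forms of matrices\<close>

text \<open>Vectors are functions on the natural numbers, so that the linearity rules below
  need no dimension hypotheses.\<close>

definition bform :: "nat \<Rightarrow> 'a::comm_ring_1 mat \<Rightarrow> (nat \<Rightarrow> 'a) \<Rightarrow> (nat \<Rightarrow> 'a) \<Rightarrow> 'a" where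
  "bform n M x y = (\<Sum>i<n. \<Sum>j<n. x i * M $$ (i, j) * y j)"

definition basis :: "nat \<Rightarrow> nat \<Rightarrow> 'a::comm_ring_1" where
  "basis r l = (if l = r then 1 else 0)"

lemma bform_add_left: "bform n M (\<lambda>l. x l + x' l) y = bform n M x y + bform n M x' y"
  by (simp add: bform_def algebra_simps sum.distrib)

lemma bform_add_right: "bform n M x (\<lambda>l. y l + y' l) = bform n M x y + bform n M x y'"
  by (simp add: bform_def algebra_simps sum.distrib)

lemma bform_scale_left: "bform n M (\<lambda>l. c * x l) y = c * bform n M x y"
  by (simp add: bform_def sum_distrib_left mult.assoc)

lemma bform_scale_right: "bform n M x (\<lambda>l. c * y l) = c * bform n M x y"
  by (simp add: bform_def sum_distrib_left algebra_simps)

lemma bform_diff_left: "bform n M (\<lambda>l. x l - x' l) y = bform n M x y - bform n M x' y"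
  by (simp add: bform_def algebra_simps sum_subtractf)

lemma bform_diff_right: "bform n M x (\<lambda>l. y l - y' l) = bform n M x y - bform n M x y'"
  by (simp add: bform_def algebra_simps sum_subtractf)

lemmas bform_linear = bform_add_left bform_add_right bform_scale_left bform_scale_right
  bform_diff_left bform_diff_right

lemma bform_commute:
  assumes "\<And>i j. i < n \<Longrightarrow> j < n \<Longrightarrow> M $$ (i, j) = M $$ (j, i)"
  shows "bform n M x y = bform n M y x"
  unfolding bform_def
  by (subst sum.swap) (intro sum.cong refl, simp add: assms mult_ac)

lemma bform_left_sum: "bform n M x y = (\<Sum>j<n. (\<Sum>i<n. x i * M $$ (i, j)) * y j)"
  unfolding bform_def by (subst sum.swap) (simp add: sum_distrib_right)

lemma sum_mult_basis: "r < n \<Longrightarrow> (\<Sum>j<n. f j * basis r j) = f r"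
  by (simp add: basis_def if_distrib[of "(*) _"] cong: if_cong)

lemma bform_basis: "p < n \<Longrightarrow> r < n \<Longrightarrow> bform n M (basis p) (basis r) = M $$ (p, r)"
proof -
  assume "p < n" "r < n"
  have "(\<Sum>i<n. basis p i * M $$ (i, r)) = (\<Sum>i<n. M $$ (i, r) * basis p i)"
    by (simp add: mult.commute)
  with \<open>p < n\<close> \<open>r < n\<close> show ?thesis
    by (simp add: bform_left_sum sum_mult_basis)
qed

lemma bform_eq_scalar_prod:
  assumes "M \<in> carrier_mat n n"
  shows "bform n M x y = vec n x \<bullet> (M *\<^sub>v vec n y)"
  using assms
  by (simp add: bform_def scalar_prod_def sum_distrib_left atLeast0LessThan mult.assoc)

lemma bform_quadratic:
  assumes "\<And>i j. i < n \<Longrightarrow> j < n \<Longrightarrow> M $$ (i, j) = M $$ (j, i)"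
  shows "bform n M (\<lambda>l. c * x l + d * y l) (\<lambda>l. c * x l + d * y l) =
    c\<^sup>2 * bform n M x x + 2 * c * d * bform n M x y + d\<^sup>2 * bform n M y y"
  using bform_commute[OF assms, of n y x]
  by (simp add: bform_linear power2_eq_square algebra_simps)

lemma discriminant_nonneg_form:
  fixes a b c :: real
  assumes "\<And>s t. 0 \<le> s\<^sup>2 * a + 2 * s * t * b + t\<^sup>2 * c"
  shows "b\<^sup>2 \<le> a * c"
proof -
  have a: "0 \<le> a" and c: "0 \<le> c"
    using assms[of 1 0] assms[of 0 1] by auto
  show ?thesis
  proof (cases "a = 0")
    case True
    then have "b = 0"
      \<comment> \<open>With \<open>a = 0\<close> the form is \<open>t (2 s b + t c)\<close>; at this point it equals \<open>- b\<^sup>2 (c + 2)\<close>.\<close>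
      using assms[of "- (c + 1)" b] c by (auto simp: power2_eq_square algebra_simps)
        (smt (verit) mult_nonneg_nonneg zero_le_square mult_eq_0_iff zero_less_mult_iff)
    then show ?thesis using True by simp
  next
    case False
    \<comment> \<open>The value at the minimiser of the form along lines of constant \<open>t\<close>.\<close>
    have "0 \<le> a * (a * c - b\<^sup>2)"
      using assms[of "- b" a] by (simp add: power2_eq_square algebra_simps)
    with a False show ?thesis
      by (simp add: zero_le_mult_iff)
  qed
qed

lemma sym_pos_def_symmetric:
  assumes "P \<in> carrier_mat n n" "sym_pos_def P" "i < n" "j < n"
  shows "P $$ (i, j) = P $$ (j, i)"
  using assms unfolding sym_pos_def_def by (metis carrier_matD index_transpose_mat(1))

lemma sym_pos_def_bform_pos:
  assumes P: "P \<in> carrier_mat n n" "sym_pos_def P" and "l < n" "x l \<noteq> 0"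
  shows "0 < bform n P x x"
proof -
  have "vec n x \<noteq> 0\<^sub>v n"
    using assms(3,4) by (metis index_vec index_zero_vec(1))
  then show ?thesis
    using P unfolding sym_pos_def_def bform_eq_scalar_prod[OF P(1)] by auto
qed

lemma sym_pos_def_bform_nonneg:
  assumes P: "P \<in> carrier_mat n n" "sym_pos_def P"
  shows "0 \<le> bform n P x x"
proof (cases "\<exists>l<n. x l \<noteq> 0")
  case True
  then show ?thesis using sym_pos_def_bform_pos[OF P] by (auto intro: less_imp_le)
next
  case False
  then show ?thesis by (simp add: bform_def)
qed

lemma sym_pos_def_Cauchy_Schwarz:
  assumes P: "P \<in> carrier_mat n n" "sym_pos_def P"
  shows "(bform n P x y)\<^sup>2 \<le> bform n P x x * bform n P y y"
proof (rule discriminant_nonneg_form)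
  fix s t
  show "0 \<le> s\<^sup>2 * bform n P x x + 2 * s * t * bform n P x y + t\<^sup>2 * bform n P y y"
    using sym_pos_def_bform_nonneg[OF P, of "\<lambda>l. s * x l + t * y l"]
      bform_quadratic[of n P s x t y] sym_pos_def_symmetric[OF P] by simp
qed

section \<open>The condition number as a bound on the spread of the quadratic form\<close>

lemma l2_norm_vec_smult: "l2_norm_vec (c \<cdot>\<^sub>v v) = norm c * l2_norm_vec v"
  by (simp add: l2_norm_vec_def L2_set_right_distrib norm_mult cong: L2_set_cong_simp)

lemma l2_norm_mult_mat_le:
  fixes X :: "real mat"
  assumes v: "v \<in> carrier_vec (dim_col X)"
  shows "l2_norm_vec (X *\<^sub>v v) \<le> spectral_norm X * l2_norm_vec v"
proof (cases "l2_norm_vec v = 0")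
  case True
  then have "v = 0\<^sub>v (dim_col X)"
    using v by (intro eq_vecI) (auto simp: l2_norm_vec_def L2_set_eq_0_iff)
  then have "X *\<^sub>v v = 0\<^sub>v (dim_row X)"
    by (intro eq_vecI) auto
  then show ?thesis
    using True by (simp add: l2_norm_vec_def L2_set_def)
next
  case False
  have bdd: "bdd_above ((\<lambda>v. l2_norm_vec (X *\<^sub>v v)) `
      {v \<in> carrier_vec (dim_col X). l2_norm_vec v = (1::real)})"
  proof (rule bdd_aboveI2)
    fix w :: "real vec" assume "w \<in> {v \<in> carrier_vec (dim_col X). l2_norm_vec v = 1}"
    then have w: "w \<in> carrier_vec (dim_col X)" "l2_norm_vec w = 1" by auto
    have le1: "\<bar>w $ j\<bar> \<le> 1" if "j < dim_col X" for j
      using member_le_L2_set[of "{..<dim_col X}" j "\<lambda>i. norm (w $ i)"] w that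
      by (simp add: l2_norm_vec_def)
    have "l2_norm_vec (X *\<^sub>v w) \<le> (\<Sum>i<dim_row X. \<bar>(X *\<^sub>v w) $ i\<bar>)"
      unfolding l2_norm_vec_def by (rule order_trans[OF L2_set_le_sum]) auto
    also have "\<dots> \<le> (\<Sum>i<dim_row X. \<Sum>j<dim_col X. \<bar>X $$ (i, j)\<bar>)"
    proof (rule sum_mono)
      fix i assume "i \<in> {..<dim_row X}"
      then have "\<bar>(X *\<^sub>v w) $ i\<bar> = \<bar>\<Sum>j<dim_col X. X $$ (i, j) * w $ j\<bar>"
        using w by (simp add: scalar_prod_def atLeast0LessThan)
      also have "\<dots> \<le> (\<Sum>j<dim_col X. \<bar>X $$ (i, j) * w $ j\<bar>)"
        by (rule sum_abs)
      also have "\<dots> \<le> (\<Sum>j<dim_col X. \<bar>X $$ (i, j)\<bar>)"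
        using le1 by (intro sum_mono) (auto simp: abs_mult intro: mult_left_le)
      finally show "\<bar>(X *\<^sub>v w) $ i\<bar> \<le> (\<Sum>j<dim_col X. \<bar>X $$ (i, j)\<bar>)" .
    qed
    finally show "l2_norm_vec (X *\<^sub>v w) \<le> (\<Sum>i<dim_row X. \<Sum>j<dim_col X. \<bar>X $$ (i, j)\<bar>)" .
  qed
  have pos: "0 < l2_norm_vec v"
    using False by (simp add: l2_norm_vec_def less_le)
  define w where "w = inverse (l2_norm_vec v) \<cdot>\<^sub>v v"
  have w: "w \<in> carrier_vec (dim_col X)" "l2_norm_vec w = 1"
    using v pos by (auto simp: w_def l2_norm_vec_smult)
  have "l2_norm_vec (X *\<^sub>v w) \<le> spectral_norm X"
    unfolding spectral_norm_def by (rule cSUP_upper[OF _ bdd]) (use w in auto)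
  moreover have "X *\<^sub>v w = inverse (l2_norm_vec v) \<cdot>\<^sub>v (X *\<^sub>v v)"
    unfolding w_def using v by (intro mult_mat_vec) auto
  ultimately show ?thesis
    using pos by (simp add: l2_norm_vec_smult field_simps)
qed

lemma l2_norm_vec_power2: "(l2_norm_vec (vec n x))\<^sup>2 = (\<Sum>i<n. (x i)\<^sup>2)" for x :: "nat \<Rightarrow> real"
  by (simp add: l2_norm_vec_def L2_set_def sum_nonneg)

lemma bform_le_spectral_norm:
  assumes X: "X \<in> carrier_mat n n"
  shows "bform n X x x \<le> spectral_norm X * (\<Sum>i<n. (x i)\<^sup>2)"
proof -
  define v where "v = vec n x"
  have v: "v \<in> carrier_vec n" by (simp add: v_def)
  have "bform n X x x = (\<Sum>i<n. v $ i * (X *\<^sub>v v) $ i)"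
    using X by (simp add: bform_eq_scalar_prod scalar_prod_def v_def atLeast0LessThan)
  also have "\<dots> \<le> (\<Sum>i<n. \<bar>v $ i\<bar> * \<bar>(X *\<^sub>v v) $ i\<bar>)"
    by (intro sum_mono) (simp flip: abs_mult)
  also have "\<dots> \<le> l2_norm_vec v * l2_norm_vec (X *\<^sub>v v)"
    using L2_set_mult_ineq[of "\<lambda>i. \<bar>v $ i\<bar>" "\<lambda>i. \<bar>(X *\<^sub>v v) $ i\<bar>" "{..<n}"] X
    by (simp add: l2_norm_vec_def v_def)
  also have "\<dots> \<le> l2_norm_vec v * (spectral_norm X * l2_norm_vec v)"
    using l2_norm_mult_mat_le[of v X] v X
    by (intro mult_left_mono) (auto simp: l2_norm_vec_def)
  also have "\<dots> = spectral_norm X * (\<Sum>i<n. (x i)\<^sup>2)"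
    by (simp add: v_def power2_eq_square flip: l2_norm_vec_power2[unfolded power2_eq_square])
  finally show ?thesis .
qed

lemma sym_pos_def_det_nonzero:
  assumes P: "P \<in> carrier_mat n n" "sym_pos_def P"
  shows "det P \<noteq> 0"
proof
  assume "det P = 0"
  then obtain v where v: "v \<in> carrier_vec n" "v \<noteq> 0\<^sub>v n" "P *\<^sub>v v = 0\<^sub>v n"
    using det_0_iff_vec_prod_zero[OF P(1)] by auto
  then have "v \<bullet> (P *\<^sub>v v) > 0"
    using P by (auto simp: sym_pos_def_def)
  with v show False by simp
qed

text \<open>This is \<open>\<lambda>\<^sub>m\<^sub>i\<^sub>n(P) \<ge> 1 / \<parallel>P\<inverse>\<parallel>\<close>.  Cauchy--Schwarz for the form of \<open>P\<close>, applied
  to \<open>x\<close> and \<open>w = P\<inverse> x\<close>, gives \<open>(x \<bullet> x)\<^sup>2 \<le> (x \<bullet> P x) (x \<bullet> P\<inverse> x)\<close>.\<close>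

lemma sum_squares_le_inverse_norm:
  assumes P: "P \<in> carrier_mat n n" "sym_pos_def P"
  shows "(\<Sum>i<n. (x i)\<^sup>2) \<le> spectral_norm (mat_inv P) * bform n P x x"
proof (cases "\<exists>l<n. x l \<noteq> 0")
  case False
  then have "bform n P x x = 0" by (simp add: bform_def)
  with False show ?thesis by simp
next
  case True
  define N where "N = (\<Sum>i<n. (x i)\<^sup>2)"
  have N: "0 < N"
    using True by (auto simp: N_def intro: sum_pos2)
  note inv = mat_inv_unit[OF P(1) sym_pos_def_det_nonzero[OF P]]
  define v where "v = vec n x"
  have v: "v \<in> carrier_vec n" by (simp add: v_def)
  define w where "w = (\<lambda>i. (mat_inv P *\<^sub>v v) $ i)"
  have w: "vec n w = mat_inv P *\<^sub>v v"
    using inv(3) by (intro eq_vecI) (auto simp: w_def)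
  have Pw: "P *\<^sub>v vec n w = v"
    unfolding w using inv v P(1) by (simp flip: assoc_mult_mat_vec)
  have "bform n P x w = N"
    using Pw by (simp add: bform_eq_scalar_prod[OF P(1)] v_def N_def scalar_prod_def
        power2_eq_square atLeast0LessThan)
  moreover have "bform n P w w = bform n (mat_inv P) x x"
    using comm_scalar_prod[of "mat_inv P *\<^sub>v v" n v] inv(3) v Pw
    by (simp add: bform_eq_scalar_prod P(1) w flip: v_def)
  ultimately have "N\<^sup>2 \<le> bform n P x x * bform n (mat_inv P) x x"
    using sym_pos_def_Cauchy_Schwarz[OF P, of x w] by simp
  also have "\<dots> \<le> bform n P x x * (spectral_norm (mat_inv P) * N)"
    unfolding N_def
    by (intro mult_left_mono bform_le_spectral_norm inv sym_pos_def_bform_nonneg[OF P])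
  finally show ?thesis
    using N unfolding N_def[symmetric] by (simp add: power2_eq_square mult_ac)
qed

text \<open>This is how the condition number enters both bounds.  The largest
  eigenvalue is at most the norm of \<open>P\<close> and the reciprocal of the smallest at most the norm of
  the inverse, so the product of the norms bounds their ratio.\<close>

lemma cond_number_bform_le:
  assumes P: "P \<in> carrier_mat n n" "sym_pos_def P" and "cond_number P \<le> \<omega>"
    and xy: "(\<Sum>i<n. (x i)\<^sup>2) \<le> (\<Sum>i<n. (y i)\<^sup>2)"
  shows "bform n P x x \<le> \<omega> * bform n P y y"
proof (cases "\<exists>l<n. y l \<noteq> 0")
  case False
  then have "(\<Sum>i<n. (x i)\<^sup>2) = 0"
    using xy by (intro antisym sum_nonneg) auto
  then have "\<forall>i<n. x i = 0"
    by (subst (asm) sum_nonneg_eq_0_iff) auto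
  with False show ?thesis by (simp add: bform_def)
next
  case True
  have S: "0 \<le> spectral_norm P"
  proof -
    obtain l where l: "l < n" "y l \<noteq> 0" using True by auto
    then have "0 < (\<Sum>i<n. (y i)\<^sup>2)" by (auto intro: sum_pos2)
    moreover have "0 \<le> spectral_norm P * (\<Sum>i<n. (y i)\<^sup>2)"
      using bform_le_spectral_norm[OF P(1), of y] sym_pos_def_bform_nonneg[OF P, of y] by simp
    ultimately show ?thesis by (simp add: zero_le_mult_iff)
  qed
  have "bform n P x x \<le> spectral_norm P * (\<Sum>i<n. (x i)\<^sup>2)"
    by (rule bform_le_spectral_norm[OF P(1)])
  also have "\<dots> \<le> spectral_norm P * (spectral_norm (mat_inv P) * bform n P y y)"
    using xy sum_squares_le_inverse_norm[OF P, of y] S by (intro mult_left_mono) auto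
  also have "\<dots> \<le> \<omega> * bform n P y y"
    using assms(3) sym_pos_def_bform_nonneg[OF P, of y]
    by (simp add: cond_number_def mult_right_mono flip: mult.assoc)
  finally show ?thesis .
qed

text \<open>Wielandt's inequality bounds \<open>(x\<^sup>T P y)\<^sup>2\<close> by a fraction of \<open>(x\<^sup>T P x) (y\<^sup>T P y)\<close>.  This is
  its linearised version, with \<open>y\<close> scaled optimally.  The vectors \<open>c x + y\<close> and \<open>c x - y\<close> have the same length, so their
  values under the form differ by a factor of at most \<open>\<omega>\<close>; the choice
  \<open>c = (\<omega> - 1) / (\<omega> + 1)\<close> is the optimal one.\<close>

lemma Wielandt_inequality:
  assumes P: "P \<in> carrier_mat n n" "sym_pos_def P" and \<omega>: "cond_number P \<le> \<omega>" "1 \<le> \<omega>"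
    and orth: "(\<Sum>i<n. x i * y i) = 0"
  shows "2 * bform n P x y - bform n P y y \<le> ((\<omega> - 1) / (\<omega> + 1))\<^sup>2 * bform n P x x"
proof -
  note sym = sym_pos_def_symmetric[OF P]
  have key: "2 * c * (\<omega> + 1) * bform n P x y \<le> (\<omega> - 1) * (c\<^sup>2 * bform n P x x + bform n P y y)"
    for c
  proof -
    have norm: "(\<Sum>i<n. (c * x i + d * y i)\<^sup>2) =
        c\<^sup>2 * (\<Sum>i<n. (x i)\<^sup>2) + 2 * c * d * (\<Sum>i<n. x i * y i) + d\<^sup>2 * (\<Sum>i<n. (y i)\<^sup>2)" for d
      by (simp add: power2_eq_square algebra_simps sum.distrib sum_distrib_left)
    have "bform n P (\<lambda>l. c * x l + 1 * y l) (\<lambda>l. c * x l + 1 * y l) \<le>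
        \<omega> * bform n P (\<lambda>l. c * x l + (- 1) * y l) (\<lambda>l. c * x l + (- 1) * y l)"
      by (rule cond_number_bform_le[OF P \<omega>(1)]) (simp only: norm orth, simp)
    then show ?thesis
      by (simp only: bform_quadratic[OF sym]) (simp add: algebra_simps)
  qed
  show ?thesis
  proof (cases "\<omega> = 1")
    \<comment> \<open>The optimal \<open>c\<close> degenerates to \<open>0\<close>, but any positive one shows that \<open>x\<^sup>T P y \<le> 0\<close>.\<close>
    case True
    then show ?thesis
      using key[of 1] sym_pos_def_bform_nonneg[OF P, of y] by simp
  next
    case False
    define c where "c = (\<omega> - 1) / (\<omega> + 1)"
    have c: "\<omega> - 1 = c * (\<omega> + 1)" "0 < c * (\<omega> + 1)"
      using False \<omega>(2) by (auto simp: c_def)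
    have "(c * (\<omega> + 1)) * (2 * bform n P x y) \<le>
        (c * (\<omega> + 1)) * (c\<^sup>2 * bform n P x x + bform n P y y)"
      using key[of c] unfolding c(1) by (simp add: algebra_simps)
    then have "2 * bform n P x y \<le> c\<^sup>2 * bform n P x x + bform n P y y"
      using c(2) by (simp only: mult_le_cancel_left_pos)
    then show ?thesis
      by (simp add: c_def)
  qed
qed

section \<open>Elimination vectors of a Higham matrix\<close>

text \<open>Row \<open>i\<close> of the active matrix is the tail of \<open>Z\<^sub>i\<^sup>T A\<close>, where \<open>Z\<^sub>i\<close> records the row
  operations applied to row \<open>k + i\<close>.  Recording them in full length makes the entries
  of the active matrix values of the form of \<open>A\<close> itself, so that the inverse of the leading
  block never appears.\<close>

lemma elimination_vector:
  fixes A :: "'a::field mat"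
  assumes A: "A \<in> carrier_mat n n" and "k \<le> n" and "\<forall>l<k. ge_pivot A l \<noteq> 0"
  shows "\<exists>Z. \<forall>i<n - k. (\<forall>l\<ge>k. Z i l = basis (k + i) l) \<and>
    (\<forall>y. bform n A (Z i) y = (\<Sum>j<n - k. ge_active A k $$ (i, j) * y (k + j)))"
proof -
  from ge_active_row_combination[OF assms] obtain m where "\<forall>i<n - k. \<forall>j<n.
      A $$ (k + i, j) - (\<Sum>l<k. m i l * A $$ (l, j)) =
      (if j < k then 0 else ge_active A k $$ (i, j - k))" ..
  then have m: "A $$ (k + i, j) - (\<Sum>l<k. m i l * A $$ (l, j)) =
      (if j < k then 0 else ge_active A k $$ (i, j - k))" if "i < n - k" "j < n" for i j
    using that by (elim allE impE) assumption+
  define Z where "Z i l = (if l < k then - m i l else basis (k + i) l)" for i l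
  have "(\<Sum>l<k + d. f l) = (\<Sum>l<k. f l) + (\<Sum>j<d. f (k + j))" for f :: "nat \<Rightarrow> 'a" and d
    by (induction d) (simp_all add: add.assoc)
  from this[of _ "n - k"]
  have split: "(\<Sum>l<n. f l) = (\<Sum>l<k. f l) + (\<Sum>j<n - k. f (k + j))" for f :: "nat \<Rightarrow> 'a"
    using \<open>k \<le> n\<close> by simp
  have row: "(\<Sum>l<n. Z i l * A $$ (l, j)) = (if j < k then 0 else ge_active A k $$ (i, j - k))"
    if ij: "i < n - k" "j < n" for i j
  proof -
    have "(\<Sum>l<n - k. Z i (k + l) * A $$ (k + l, j)) = (\<Sum>l<n - k. A $$ (k + l, j) * basis i l)"
      by (intro sum.cong) (auto simp: Z_def basis_def)
    also have "\<dots> = A $$ (k + i, j)"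
      using ij by (simp add: sum_mult_basis)
    finally have "(\<Sum>l<n. Z i l * A $$ (l, j)) =
        A $$ (k + i, j) - (\<Sum>l<k. m i l * A $$ (l, j))"
      by (simp add: split Z_def sum_negf)
    then show ?thesis using m[OF ij] by simp
  qed
  have "bform n A (Z i) y = (\<Sum>j<n - k. ge_active A k $$ (i, j) * y (k + j))"
    if i: "i < n - k" for i y
  proof -
    have "(\<Sum>j<k. (\<Sum>l<n. Z i l * A $$ (l, j)) * y j) = 0"
      using row[OF i] \<open>k \<le> n\<close> by (intro sum.neutral) simp
    moreover have "(\<Sum>j<n - k. (\<Sum>l<n. Z i l * A $$ (l, k + j)) * y (k + j)) =
        (\<Sum>j<n - k. ge_active A k $$ (i, j) * y (k + j))"
      using row[OF i] by (intro sum.cong) auto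
    ultimately show ?thesis
      by (simp add: bform_left_sum split[of "\<lambda>j. (\<Sum>l<n. Z i l * A $$ (l, j)) * y j"])
  qed
  then show ?thesis
    by (intro exI[of _ Z]) (auto simp: Z_def)
qed

locale higham_pair =
  fixes n :: nat and B C :: "real mat"
  assumes B: "B \<in> carrier_mat n n" "sym_pos_def B"
    and C: "C \<in> carrier_mat n n" "sym_pos_def C"
begin

abbreviation A :: "complex mat" where "A \<equiv> complex_mat B C"

lemma carrier_A: "A \<in> carrier_mat n n"
  using B C by (auto simp: complex_mat_def)

lemma A_entry: "i < n \<Longrightarrow> j < n \<Longrightarrow> A $$ (i, j) = Complex (B $$ (i, j)) (C $$ (i, j))"
  using B C by (auto simp: complex_mat_def complex_eq_iff)

lemma bform_A_commute: "bform n A x y = bform n A y x"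
  by (rule bform_commute)
    (simp add: A_entry sym_pos_def_symmetric[OF B] sym_pos_def_symmetric[OF C])

lemma bform_A_of_real:
  "bform n A (\<lambda>l. of_real (u l)) (\<lambda>l. of_real (v l)) = Complex (bform n B u v) (bform n C u v)"
  by (simp add: bform_def A_entry complex_eq_iff)

text \<open>For the real part \<open>e\<close> and the imaginary part \<open>f\<close> of \<open>Z\<close> the cross terms are
  \<open>i (f\<^sup>T A e - e\<^sup>T A f)\<close>, which vanish because \<open>A\<close> is symmetric.\<close>

lemma bform_A_cnj:
  "bform n A Z (\<lambda>l. cnj (Z l)) =
    Complex (bform n B (\<lambda>l. Re (Z l)) (\<lambda>l. Re (Z l)) + bform n B (\<lambda>l. Im (Z l)) (\<lambda>l. Im (Z l)))
            (bform n C (\<lambda>l. Re (Z l)) (\<lambda>l. Re (Z l)) + bform n C (\<lambda>l. Im (Z l)) (\<lambda>l. Im (Z l)))"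
proof -
  define e f :: "nat \<Rightarrow> complex" where "e l = of_real (Re (Z l))" and "f l = of_real (Im (Z l))" for l
  have Z: "Z = (\<lambda>l. e l + \<i> * f l)" "(\<lambda>l. cnj (Z l)) = (\<lambda>l. e l - \<i> * f l)"
    by (auto simp: e_def f_def complex_eq_iff fun_eq_iff)
  have "bform n A Z (\<lambda>l. cnj (Z l)) =
      bform n A (\<lambda>l. e l + \<i> * f l) (\<lambda>l. e l - \<i> * f l)"
    by (simp only: Z(2)) (simp only: Z(1))
  also have "\<dots> = bform n A e e + bform n A f f"
    using bform_A_commute[of f e] by (simp add: bform_linear algebra_simps)
  finally show ?thesis
    by (simp add: e_def[abs_def] f_def[abs_def] bform_A_of_real complex_eq_iff)
qed

lemma bform_A_cnj_nonneg: "0 \<le> Re (bform n A Z (\<lambda>l. cnj (Z l)))"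
  "0 \<le> Im (bform n A Z (\<lambda>l. cnj (Z l)))"
  by (simp_all add: bform_A_cnj sym_pos_def_bform_nonneg[OF B] sym_pos_def_bform_nonneg[OF C])

end

section \<open>The diagonal of the active matrix\<close>

text \<open>The stage reached after \<open>k\<close> steps of elimination, with the elimination vectors that
  \<open>elimination_vector\<close> provides as long as the earlier pivots are nonzero.  Stage \<open>0\<close> is
  the given matrix.\<close>

locale higham_stage = higham_pair +
  fixes k :: nat and Z :: "nat \<Rightarrow> nat \<Rightarrow> complex"
  assumes k: "k < n"
    and Z_tail: "\<And>i l. i < n - k \<Longrightarrow> k \<le> l \<Longrightarrow> Z i l = basis (k + i) l"
    and Z_form: "\<And>i y. i < n - k \<Longrightarrow>
      bform n A (Z i) y = (\<Sum>j<n - k. ge_active A k $$ (i, j) * y (k + j))"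
begin

abbreviation S :: "complex mat" where "S \<equiv> ge_active A k"

text \<open>The first \<open>k\<close> values of \<open>y\<close> are free.  This freedom is used with \<open>y\<close> a basis vector,
  an elimination vector and the conjugate of one.\<close>

lemma Z_form_entry:
  assumes "i < n - k" "j < n - k" "\<And>l. l < n - k \<Longrightarrow> y (k + l) = basis j l"
  shows "bform n A (Z i) y = S $$ (i, j)"
  using assms by (simp add: Z_form sum_mult_basis)

lemma S_symmetric:
  assumes "i < n - k" "j < n - k"
  shows "S $$ (i, j) = S $$ (j, i)"
  using Z_form_entry[of i j "Z j"] Z_form_entry[of j i "Z i"] assms bform_A_commute[of "Z i" "Z j"]
  by (simp add: Z_tail basis_def)

lemma S_cnj: "i < n - k \<Longrightarrow> j < n - k \<Longrightarrow> S $$ (i, j) = bform n A (Z i) (\<lambda>l. cnj (Z j l))"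
  by (subst Z_form_entry) (auto simp: Z_tail basis_def)

text \<open>The real and the imaginary part of \<open>S\<close> are positive semidefinite; only their
  \<open>2 \<times> 2\<close> principal submatrices are needed to compare entries with the diagonal.\<close>

lemma S_quadratic_nonneg:
  assumes i: "i < n - k" and j: "j < n - k"
  defines "q s t \<equiv> of_real (s\<^sup>2) * S $$ (i, i) + of_real (2 * s * t) * S $$ (i, j)
    + of_real (t\<^sup>2) * S $$ (j, j)"
  shows "0 \<le> Re (q s t)" "0 \<le> Im (q s t)"
proof -
  have "q s t = bform n A (\<lambda>l. of_real s * Z i l + of_real t * Z j l)
      (\<lambda>l. cnj (of_real s * Z i l + of_real t * Z j l))"
    using S_symmetric[OF i j]
    by (simp add: q_def bform_linear power2_eq_square algebra_simps flip: S_cnj[OF i i]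
        S_cnj[OF i j] S_cnj[OF j i] S_cnj[OF j j])
  then show "0 \<le> Re (q s t)" "0 \<le> Im (q s t)"
    by (simp_all only: bform_A_cnj_nonneg)
qed

text \<open>Both parts of \<open>S\<close> satisfy \<open>m\<^sub>i\<^sub>j\<^sup>2 \<le> m\<^sub>i\<^sub>i m\<^sub>j\<^sub>j\<close>, and the two right-hand sides add up to
  the scalar product of \<open>S\<^sub>i\<^sub>i\<close> and \<open>S\<^sub>j\<^sub>j\<close> as plane vectors.\<close>

lemma S_entry_le_diagonal:
  assumes i: "i < n - k" and j: "j < n - k"
  shows "cmod (S $$ (i, j)) \<le> max (cmod (S $$ (i, i))) (cmod (S $$ (j, j)))" (is "_ \<le> ?m")
proof -
  have "(Re (S $$ (i, j)))\<^sup>2 \<le> Re (S $$ (i, i)) * Re (S $$ (j, j))"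
    using S_quadratic_nonneg(1)[OF i j] by (intro discriminant_nonneg_form) simp
  moreover have "(Im (S $$ (i, j)))\<^sup>2 \<le> Im (S $$ (i, i)) * Im (S $$ (j, j))"
    using S_quadratic_nonneg(2)[OF i j] by (intro discriminant_nonneg_form) simp
  ultimately have "(cmod (S $$ (i, j)))\<^sup>2 \<le> Re (S $$ (i, i) * cnj (S $$ (j, j)))"
    by (simp add: cmod_power2)
  also have "\<dots> \<le> cmod (S $$ (i, i) * cnj (S $$ (j, j)))"
    by (rule complex_Re_le_cmod)
  also have "\<dots> \<le> ?m\<^sup>2"
    unfolding norm_mult complex_mod_cnj power2_eq_square
    by (intro mult_mono) (auto simp: le_max_iff_disj)
  finally show ?thesis
    by (rule power2_le_imp_le) (simp add: le_max_iff_disj)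
qed

lemma S_diag_ge_form:
  assumes i: "i < n - k"
  shows "bform n B (\<lambda>l. Re (Z i l)) (\<lambda>l. Re (Z i l)) \<le> Re (S $$ (i, i))"
    and "bform n C (\<lambda>l. Re (Z i l)) (\<lambda>l. Re (Z i l)) \<le> Im (S $$ (i, i))"
  by (simp_all add: S_cnj[OF i i] bform_A_cnj sym_pos_def_bform_nonneg[OF B]
      sym_pos_def_bform_nonneg[OF C])

lemma S_diag_pos:
  assumes i: "i < n - k"
  shows "0 < Re (S $$ (i, i))" "0 < Im (S $$ (i, i))"
proof -
  have r: "k + i < n" "Re (Z i (k + i)) \<noteq> 0"
    using i by (auto simp: Z_tail basis_def)
  show "0 < Re (S $$ (i, i))" "0 < Im (S $$ (i, i))"
    using S_diag_ge_form[OF i] r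
      sym_pos_def_bform_pos[OF B, of "k + i" "\<lambda>l. Re (Z i l)"]
      sym_pos_def_bform_pos[OF C, of "k + i" "\<lambda>l. Re (Z i l)"] by auto
qed

section \<open>The growth bounds\<close>

text \<open>The real part of the elimination vector has entry \<open>1\<close> at position \<open>k + i\<close>, hence is at least
  as long as every basis vector; so the forms of \<open>B\<close> and \<open>C\<close> at it are not smaller than
  any diagonal entry of \<open>B\<close> and \<open>C\<close> divided by \<open>\<omega>\<close>.\<close>

lemma A_diag_le_S_diag:
  assumes i: "i < n - k" and p: "p < n"
    and \<omega>: "cond_number B \<le> \<omega>" "cond_number C \<le> \<omega>" "1 \<le> \<omega>"
  shows "cmod (A $$ (p, p)) \<le> \<omega> * cmod (S $$ (i, i))"
proof -
  define e where "e l = Re (Z i l)" for l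
  have "(\<Sum>l<n. (basis p l)\<^sup>2) = (1::real)"
    using p by (simp add: basis_def if_distrib[of "\<lambda>x. x\<^sup>2"] cong: if_cong)
  also have "\<dots> = (e (k + i))\<^sup>2"
    using i by (simp add: e_def Z_tail basis_def)
  also have "\<dots> \<le> (\<Sum>l<n. (e l)\<^sup>2)"
    using i by (intro member_le_sum) auto
  finally have le: "(\<Sum>l<n. (basis p l)\<^sup>2) \<le> (\<Sum>l<n. (e l)\<^sup>2)" .
  have nonneg: "0 \<le> B $$ (p, p)" "0 \<le> C $$ (p, p)"
    using sym_pos_def_bform_nonneg[OF B, of "basis p"] sym_pos_def_bform_nonneg[OF C, of "basis p"]
    by (simp_all add: bform_basis p)
  have "B $$ (p, p) \<le> \<omega> * bform n B e e" "C $$ (p, p) \<le> \<omega> * bform n C e e"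
    using cond_number_bform_le[OF B \<omega>(1) le] cond_number_bform_le[OF C \<omega>(2) le]
    by (simp_all add: bform_basis p)
  then have "B $$ (p, p) \<le> \<omega> * Re (S $$ (i, i))" "C $$ (p, p) \<le> \<omega> * Im (S $$ (i, i))"
    using S_diag_ge_form[OF i] \<omega>(3) unfolding e_def
    by (meson mult_left_mono order_trans zero_le_one)+
  then have "(B $$ (p, p))\<^sup>2 + (C $$ (p, p))\<^sup>2 \<le> (\<omega> * Re (S $$ (i, i)))\<^sup>2 + (\<omega> * Im (S $$ (i, i)))\<^sup>2"
    using nonneg by (intro add_mono power_mono) auto
  then have "(cmod (A $$ (p, p)))\<^sup>2 \<le> (\<omega> * cmod (S $$ (i, i)))\<^sup>2"
    using p by (simp add: A_entry cmod_power2 power_mult_distrib distrib_left)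
  then show ?thesis
    by (rule power2_le_imp_le) (use \<omega> in simp)
qed

text \<open>The angle \<open>\<alpha>\<close> is fixed by the demand that \<open>e\<^sup>3\<^sup>i\<^sup>\<alpha> s\<close> be \<open>- \<bar>s\<bar>\<close>.  Passing to
  \<open>w = e\<^sup>2\<^sup>i\<^sup>\<alpha> z\<close> is then the rotation that serves two purposes at once: it turns the factor
  \<open>e\<^sup>3\<^sup>i\<^sup>\<alpha>\<close> in front of \<open>z\<^sup>T A z\<close> into \<open>e\<^sup>-\<^sup>i\<^sup>\<alpha>\<close>, so that real vectors contribute
  \<open>cos \<alpha>\<close> and \<open>sin \<alpha>\<close> times their values under \<open>B\<close> and \<open>C\<close>; and it gives the terms mixing the
  real part of \<open>w\<close> with \<open>e\<^sub>r\<close> the conjugate factor \<open>e\<^sup>i\<^sup>\<alpha>\<close>, with the same two weights up to a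
  sign.\<close>

lemma S_diag_le_A_diag:
  assumes i: "i < n - k"
    and \<omega>: "cond_number B \<le> \<omega>" "cond_number C \<le> \<omega>" "1 \<le> \<omega>"
  shows "cmod (S $$ (i, i)) \<le> (1 + ((\<omega> - 1) / (\<omega> + 1))\<^sup>2) * cmod (A $$ (k + i, k + i))"
proof -
  define t where "t = ((\<omega> - 1) / (\<omega> + 1))\<^sup>2"
  define r where "r = k + i"
  have r: "r < n" using i by (simp add: r_def)
  define s a where "s = S $$ (i, i)" and "a = A $$ (r, r)"
  define \<alpha> where "\<alpha> = (pi - Arg s) / 3"
  have s: "0 < Im s"
    using S_diag_pos[OF i] by (simp add: s_def)
  have "Im s = cmod s * sin (Arg s)"
    by (metis Im_rcis rcis_cmod_Arg)
  with s have "0 < sin (Arg s)"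
    by (metis norm_ge_zero zero_less_mult_pos2 mult.commute zero_less_mult_iff not_less)
  then have "0 < Arg s" "Arg s \<le> pi"
    using Arg_bounded[of s] sin_ge_zero[of "- Arg s"] by (cases "0 < Arg s"; simp)+
  \<comment> \<open>Positivity of \<open>Im s\<close> alone already places \<open>\<alpha>\<close> in \<open>[0, \<pi> / 3)\<close>.\<close>
  then have \<alpha>: "0 \<le> cos \<alpha>" "0 \<le> sin \<alpha>"
    by (auto simp: \<alpha>_def intro!: cos_ge_zero sin_ge_zero)
  have "3 * \<alpha> = pi - Arg s"
    by (simp add: \<alpha>_def)
  then have "cis (3 * \<alpha>) = - cis (- Arg s)"
    by (simp add: complex_eq_iff)
  moreover have "cis (- Arg s) * s = of_real (cmod s)"
    using rcis_cmod_Arg[of s] by (metis cis_inverse cis_neq_zero left_inverse mult.assoc mult.commute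
        mult.right_neutral rcis_def)
  ultimately have rot: "cis (3 * \<alpha>) * s = - of_real (cmod s)"
    by simp

  define e z w where "e = (basis r :: nat \<Rightarrow> complex)" and "z l = e l - Z i l"
    and "w l = cis (2 * \<alpha>) * z l" for l
  define u v where "u l = Re (w l)" and "v l = Im (w l)" for l
  define U V :: "nat \<Rightarrow> complex" where "U l = of_real (u l)" and "V l = of_real (v l)" for l
  have z0: "z l = 0" if "k \<le> l" for l
    using i that by (simp add: z_def e_def r_def Z_tail)
  \<comment> \<open>On the first \<open>k\<close> positions \<open>Z\<^sup>T A\<close> vanishes, so \<open>z\<close> and \<open>e\<close> act alike there.\<close>
  have z_left: "bform n A z y = bform n A e y" if "\<And>l. k \<le> l \<Longrightarrow> y l = 0" for y
    using that i by (simp add: z_def[abs_def] bform_diff_left Z_form)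
  have "bform n A (Z i) e = s"
    unfolding s_def using i by (intro Z_form_entry) (auto simp: e_def r_def basis_def)
  moreover have "bform n A e e = a"
    using r by (simp add: e_def a_def bform_basis)
  ultimately have "bform n A z e = a - s"
    by (simp add: z_def[abs_def] bform_diff_left)
  then have zz: "bform n A z z = a - s"
    using z_left[of z] z0 bform_A_commute[of e z] by simp
  have Uz: "bform n A U z = bform n A U e"
    using z_left[of U] z0 bform_A_commute[of U] by (simp add: U_def u_def w_def)
  \<comment> \<open>Completing the square: \<open>w\<^sup>T A w - 2 U\<^sup>T A w + U\<^sup>T A U\<close> is the form at \<open>w - U = i V\<close>.\<close>
  have "w = (\<lambda>l. U l + \<i> * V l)"
    by (auto simp: U_def V_def u_def v_def complex_eq_iff)
  then have "bform n A w w = 2 * bform n A U w - bform n A U U - bform n A V V"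
    using bform_A_commute[of V U] by (simp add: bform_linear algebra_simps)
  moreover have "bform n A w w = cis (4 * \<alpha>) * bform n A z z"
    by (simp add: w_def[abs_def] bform_linear cis_mult flip: mult.assoc)
  moreover have "bform n A U w = cis (2 * \<alpha>) * bform n A U e"
    by (simp add: w_def[abs_def] bform_linear Uz)
  ultimately have square: "cis (4 * \<alpha>) * (a - s) =
      2 * (cis (2 * \<alpha>) * bform n A U e) - bform n A U U - bform n A V V"
    by (simp only: zz)
  have cis: "cis (- \<alpha>) * cis (4 * \<alpha>) = cis (3 * \<alpha>)" "cis (- \<alpha>) * cis (2 * \<alpha>) = cis \<alpha>"
    by (simp_all add: cis_mult)
  have "cis (3 * \<alpha>) * (a - s) = cis (- \<alpha>) * (cis (4 * \<alpha>) * (a - s))"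
    by (simp only: cis flip: mult.assoc)
  also have "\<dots> = 2 * ((cis (- \<alpha>) * cis (2 * \<alpha>)) * bform n A U e)
      - cis (- \<alpha>) * bform n A U U - cis (- \<alpha>) * bform n A V V"
    unfolding square by (simp only: right_diff_distrib mult_ac)
  finally have "of_real (cmod s) = - cis (3 * \<alpha>) * a + 2 * (cis \<alpha> * bform n A U e)
      - cis (- \<alpha>) * bform n A U U - cis (- \<alpha>) * bform n A V V"
    using rot unfolding cis by (simp add: right_diff_distrib eq_diff_eq add_ac)
  from arg_cong[OF this, of Re]
  have "cmod s = Re (- cis (3 * \<alpha>) * a) + 2 * Re (cis \<alpha> * bform n A U e)
      - Re (cis (- \<alpha>) * bform n A U U) - Re (cis (- \<alpha>) * bform n A V V)"
    by simp
  also have "\<dots> = Re (- cis (3 * \<alpha>) * a)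
      + cos \<alpha> * (2 * bform n B u (basis r) - bform n B u u)
      + sin \<alpha> * (- 2 * bform n C u (basis r) - bform n C u u)
      - (cos \<alpha> * bform n B v v + sin \<alpha> * bform n C v v)"
  proof -
    have e: "e = (\<lambda>l. of_real (basis r l))"
      by (auto simp: e_def basis_def)
    show ?thesis
      unfolding e U_def[abs_def] V_def[abs_def] bform_A_of_real
      by (simp add: algebra_simps)
  qed
  also have "\<dots> \<le> cmod a + cos \<alpha> * (t * B $$ (r, r)) + sin \<alpha> * (t * C $$ (r, r)) - 0"
  proof (intro add_mono diff_mono mult_left_mono \<alpha>)
    have "u r = 0"
      by (simp add: u_def w_def z0 r_def)
    then have orth: "(\<Sum>l<n. basis r l * u l) = 0" "(\<Sum>l<n. basis r l * (- 1 * u l)) = 0"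
      by (auto simp: basis_def intro!: sum.neutral)
    show "2 * bform n B u (basis r) - bform n B u u \<le> t * B $$ (r, r)"
      using Wielandt_inequality[OF B \<omega>(1,3) orth(1)]
        bform_commute[OF sym_pos_def_symmetric[OF B], of n u "basis r"]
      by (simp add: t_def bform_basis r)
    \<comment> \<open>For \<open>C\<close> the correction enters with the opposite sign, since \<open>Im (e\<^sup>i\<^sup>\<alpha>) = - Im (e\<^sup>-\<^sup>i\<^sup>\<alpha>)\<close>.\<close>
    show "- 2 * bform n C u (basis r) - bform n C u u \<le> t * C $$ (r, r)"
      using Wielandt_inequality[OF C \<omega>(2,3) orth(2)]
        bform_commute[OF sym_pos_def_symmetric[OF C], of n u "basis r"]
      unfolding bform_linear by (simp add: t_def bform_basis r)
    show "Re (- cis (3 * \<alpha>) * a) \<le> cmod a"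
      using complex_Re_le_cmod[of "- cis (3 * \<alpha>) * a"] by (simp add: norm_mult)
    show "0 \<le> cos \<alpha> * bform n B v v + sin \<alpha> * bform n C v v"
      using \<alpha> sym_pos_def_bform_nonneg[OF B] sym_pos_def_bform_nonneg[OF C] by simp
  qed
  also have "\<dots> = cmod a + t * Re (cis (- \<alpha>) * a)"
    using r by (simp add: a_def A_entry algebra_simps)
  also have "\<dots> \<le> cmod a + t * cmod a"
    using complex_Re_le_cmod[of "cis (- \<alpha>) * a"]
    by (intro add_mono mult_left_mono) (auto simp: norm_mult t_def)
  finally show ?thesis
    by (simp add: s_def a_def r_def t_def algebra_simps)
qed

lemma max_entry_S: "\<exists>i<n - k. max_entry S = cmod (S $$ (i, i))"
  and S_entry_le_max_entry: "i < n - k \<Longrightarrow> j < n - k \<Longrightarrow> cmod (S $$ (i, j)) \<le> max_entry S"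
proof -
  have elems: "elements_mat S = (\<lambda>(i, j). S $$ (i, j)) ` ({..<n - k} \<times> {..<n - k})"
    using ge_active_carrier[OF carrier_A, of k] by (auto simp: elements_mat_def)
  then have fin: "finite (cmod ` elements_mat S)" "cmod ` elements_mat S \<noteq> {}"
    using k by (auto simp: lessThan_empty_iff)
  show le: "cmod (S $$ (i, j)) \<le> max_entry S" if "i < n - k" "j < n - k" for i j
    unfolding max_entry_def using fin that by (intro Max_ge) (auto simp: elems)
  have "max_entry S \<in> cmod ` elements_mat S"
    unfolding max_entry_def using fin by (rule Max_in)
  then obtain i j where ij: "i < n - k" "j < n - k" "max_entry S = cmod (S $$ (i, j))"
    by (auto simp: elems)
  then show "\<exists>i<n - k. max_entry S = cmod (S $$ (i, i))"
    using S_entry_le_diagonal[OF ij(1,2)] le[of i i] le[of j j]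
    by (auto simp: max_def split: if_splits intro: antisym)
qed

end

context higham_pair
begin

lemma stage_if_pivots_nonzero:
  assumes "k < n" "\<forall>l<k. ge_pivot A l \<noteq> 0"
  shows "\<exists>Z. higham_stage n B C k Z"
  using elimination_vector[OF carrier_A _ assms(2)] assms(1) B C
  by (auto simp: higham_stage_def higham_stage_axioms_def higham_pair_def)

text \<open>The pivot is the first diagonal entry of the active matrix, whose real part is positive
  by \<open>S_diag_pos\<close> once the earlier pivots are known to be nonzero.\<close>

lemma pivot_nonzero: "k < n \<Longrightarrow> ge_pivot A k \<noteq> 0"
proof (induction k rule: less_induct)
  case (less k)
  then obtain Z where "higham_stage n B C k Z"
    using stage_if_pivots_nonzero[of k] by auto
  from higham_stage.S_diag_pos(1)[OF this, of 0] less.prems show ?case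
    by (auto simp: ge_pivot_def)
qed

lemma stage_exists: "k < n \<Longrightarrow> \<exists>Z. higham_stage n B C k Z"
  using stage_if_pivots_nonzero pivot_nonzero by simp

lemma stage_growth_bounds:
  assumes k: "k < n" and \<omega>: "cond_number B \<le> \<omega>" "cond_number C \<le> \<omega>" "1 \<le> \<omega>"
  shows "1 / \<omega> \<le> stage_growth A k" "stage_growth A k \<le> 1 + ((\<omega> - 1) / (\<omega> + 1))\<^sup>2"
proof -
  obtain Z where "higham_stage n B C k Z" using stage_exists[OF k] by blast
  then interpret S: higham_stage n B C k Z .
  have "0 < n" using k by simp
  \<comment> \<open>Stage \<open>0\<close> shows that the largest entry of \<open>A\<close> itself is on the diagonal.\<close>
  from stage_exists[OF this] obtain Z0 where "higham_stage n B C 0 Z0" by blast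
  then interpret A: higham_stage n B C 0 Z0 .
  obtain p where p: "p < n" "max_entry A = cmod (A $$ (p, p))"
    using A.max_entry_S by auto
  obtain i where i: "i < n - k" "max_entry (ge_active A k) = cmod (ge_active A k $$ (i, i))"
    using S.max_entry_S by auto
  have pos: "0 < max_entry A"
    using A.S_diag_pos(1)[of p] p by auto
  have "max_entry A \<le> \<omega> * max_entry (ge_active A k)"
    using S.A_diag_le_S_diag[OF i(1) p(1) \<omega>] p i by simp
  then show "1 / \<omega> \<le> stage_growth A k"
    using pos \<omega>(3) by (simp add: stage_growth_def field_simps)
  have "max_entry (ge_active A k) \<le> (1 + ((\<omega> - 1) / (\<omega> + 1))\<^sup>2) * cmod (A $$ (k + i, k + i))"
    using S.S_diag_le_A_diag[OF i(1) \<omega>] i by simp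
  also have "\<dots> \<le> (1 + ((\<omega> - 1) / (\<omega> + 1))\<^sup>2) * max_entry A"
    using A.S_entry_le_max_entry[of "k + i" "k + i"] i by (intro mult_left_mono) auto
  finally show "stage_growth A k \<le> 1 + ((\<omega> - 1) / (\<omega> + 1))\<^sup>2"
    using pos by (simp add: stage_growth_def pos_divide_le_eq)
qed

end

theorem theorem1p3:
  fixes n :: nat and A :: "complex mat" and B C :: "real mat" and \<omega> :: real
  assumes "n \<ge> 2"
    and "A \<in> higham_mats n"
    and "B \<in> carrier_mat n n" and "C \<in> carrier_mat n n"
    and "A = complex_mat B C"
    and "1 \<le> \<omega>"
    and "max (cond_number B) (cond_number C) \<le> \<omega>"
  shows "ge_well_defined A \<and>
    (\<forall>k\<in>{1..n - 1}.
       1 / \<omega> \<le> stage_growth A k \<and>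
       stage_growth A k \<le> 2 * (1 + \<omega>\<^sup>2) / (1 + \<omega>)\<^sup>2) \<and>
    1 / \<omega> \<le> growth_factor A \<and>
    growth_factor A \<le> 2 * (1 + \<omega>\<^sup>2) / (1 + \<omega>)\<^sup>2"
proof -
  obtain P Q where PQ: "P \<in> carrier_mat n n" "Q \<in> carrier_mat n n" "sym_pos_def P" "sym_pos_def Q"
    and "A = complex_mat P Q"
    using assms(2) by (auto simp: higham_mats_def)
  \<comment> \<open>Membership only provides some positive definite parts, but the parts of a matrix are unique.\<close>
  have eq: "B = P \<and> C = Q"
  proof -
    have "P $$ (i, j) = B $$ (i, j) \<and> Q $$ (i, j) = C $$ (i, j)" if "i < n" "j < n" for i j
    proof -
      have "complex_mat P Q $$ (i, j) = complex_mat B C $$ (i, j)"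
        using \<open>A = complex_mat P Q\<close> assms(5) by simp
      then show ?thesis
        using that PQ(1,2) assms(3,4) by (simp add: complex_mat_def complex_eq_iff)
    qed
    then show ?thesis
      using PQ(1,2) assms(3,4) by (auto intro!: eq_matI)
  qed
  interpret higham_pair n B C
    using PQ eq by unfold_locales auto
  have dim: "dim_row A = n"
    using carrier_A assms(5) by auto
  have "1 + ((\<omega> - 1) / (\<omega> + 1))\<^sup>2 = 2 * (1 + \<omega>\<^sup>2) / (1 + \<omega>)\<^sup>2"
  proof -
    have "1 + \<omega> \<noteq> 0" using assms(6) by simp
    then have "1 + ((\<omega> - 1) / (1 + \<omega>))\<^sup>2 = ((1 + \<omega>)\<^sup>2 + (\<omega> - 1)\<^sup>2) / (1 + \<omega>)\<^sup>2"
      by (simp add: power_divide add_divide_distrib)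
    also have "(1 + \<omega>)\<^sup>2 + (\<omega> - 1)\<^sup>2 = 2 * (1 + \<omega>\<^sup>2)"
      by (simp add: power2_eq_square algebra_simps)
    finally show ?thesis by (simp add: add.commute)
  qed
  then have stage: "1 / \<omega> \<le> stage_growth A k \<and> stage_growth A k \<le> 2 * (1 + \<omega>\<^sup>2) / (1 + \<omega>)\<^sup>2"
    if "k \<in> {1..n - 1}" for k
    using stage_growth_bounds[of k \<omega>] assms(1,5-7) that by auto
  have "growth_factor A \<in> stage_growth A ` {1..n - 1}"
  proof -
    have "Max ((\<lambda>k. max_entry (ge_active A k)) ` {1..n - 1}) \<in>
        (\<lambda>k. max_entry (ge_active A k)) ` {1..n - 1}"
      using assms(1) by (intro Max_in) auto
    then show ?thesis
      by (auto simp: growth_factor_def stage_growth_def dim)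
  qed
  moreover have "ge_well_defined A"
    using pivot_nonzero assms(5) dim by (simp add: ge_well_defined_def)
  ultimately show ?thesis
    using stage by auto
qed

end
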